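(* Let $d\ge3$ be an integer and fix real numbers $\mu\ne0$, $\alpha\ge0$, $\beta\ge0$ with $\alpha+\beta>0$. For $T\ge0$ let $z_0=z_0(T)>0$ be the unique positive solution of $$4\pi T=\frac{d}{z_0}-\frac{(d-2)^2\mu^2z_0}{2(d-1)}-\beta z_0-\alpha ,$$ and put $$\sigma_{DC}(T)=z_0^{-(d-3)}\left(1+\frac{(d-2)^2\mu^2}{2\beta+\alpha z_0^{-1}}\right).$$ Then $z_0(T)$ is strictly decreasing in $T$, and: (i) if $d=3$ and $\alpha>0$, then $\sigma_{DC}$ is strictly decreasing in $T$; if $d=3$ and $\alpha=0$, then $\sigma_{DC}$ is independent of $T$; (ii) if $d>3$, then $\sigma_{DC}$ is strictly increasing in $T$.
   Context: Here $\sigma_{DC}$ is the DC conductivity of a charged black brane in $d+1$ bulk dimensions with chemical potential $\mu$, horizon position $z_0$ and temperature $T$; $\alpha=a_{1/2}c_{1/2}$ and $\beta=a_1c_1^2$ are the parameters of the background scalar profiles. All of these enter only through the formulas in the claim. *)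

theory Defs
  imports "HOL-Analysis.Analysis"
begin

definition horizon_eq :: "nat \<Rightarrow> real \<Rightarrow> real \<Rightarrow> real \<Rightarrow> real \<Rightarrow> real \<Rightarrow> bool" where
  "horizon_eq d \<mu> \<alpha> \<beta> T z \<longleftrightarrow>
     4 * pi * T = real d / z - (real d - 2)^2 * \<mu>^2 * z / (2 * (real d - 1)) - \<beta> * z - \<alpha>"

definition z0 :: "nat \<Rightarrow> real \<Rightarrow> real \<Rightarrow> real \<Rightarrow> real \<Rightarrow> real" where
  "z0 d \<mu> \<alpha> \<beta> T = (THE z. z > 0 \<and> horizon_eq d \<mu> \<alpha> \<beta> T z)"

definition sigma_DC :: "nat \<Rightarrow> real \<Rightarrow> real \<Rightarrow> real \<Rightarrow> real \<Rightarrow> real" where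
  "sigma_DC d \<mu> \<alpha> \<beta> T =
     (let z = z0 d \<mu> \<alpha> \<beta> T
      in z powi (- (int d - 3)) * (1 + (real d - 2)^2 * \<mu>^2 / (2 * \<beta> + \<alpha> * inverse z)))"

end

theory Submission
  imports Defs
begin

text \<open>
  The right-hand side of the horizon equation is \<open>d / z - a * z - \<alpha>\<close> with \<open>a > 0\<close>, which
  decreases strictly in \<open>z\<close>; this gives uniqueness and the monotonicity of the horizon position, and
  clearing the denominator turns existence into a quadratic equation. With \<open>n = d - 3\<close> and
  \<open>K = (d - 2)\<^sup>2 * \<mu>\<^sup>2\<close>, the conductivity at \<open>z\<close> is
  \<open>z\<^sup>-\<^sup>n + K * z\<^sup>-\<^sup>(\<^sup>n\<^sup>-\<^sup>1\<^sup>) / (2 * \<beta> * z + \<alpha>)\<close>. For \<open>n \<ge> 1\<close> the first summand decreases strictly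
  in \<open>z\<close> and the second one weakly; for \<open>n = 0\<close> only \<open>K / (2 * \<beta> + \<alpha> / z)\<close> varies.
\<close>

lemma divide_minus_mult_strict_antimono:
  fixes a c z w :: real
  assumes "a > 0" "c > 0" "0 < z" "z < w"
  shows "c / w - a * w < c / z - a * z"
proof -
  have "c / w < c / z"
    using assms by (intro divide_strict_left_mono) auto
  moreover have "a * z < a * w"
    using assms by simp
  ultimately show ?thesis by linarith
qed

lemma divide_minus_mult_surj:
  fixes a c B :: real
  assumes "a > 0" "c > 0"
  obtains z where "z > 0" "c / z - a * z = B"
proof -
  \<comment> \<open>\<open>s\<close> is the root of the discriminant of
    \<open>a * z\<^sup>2 + B * z - c\<close>, and \<open>z\<close> is the root taken with
    \<open>+ s\<close>; since \<open>s\<close> exceeds \<open>\<bar>B\<bar>\<close>, it is positive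
    whatever the sign of \<open>B\<close>.\<close>
  define s where "s = sqrt (B\<^sup>2 + 4 * a * c)"
  define z where "z = (s - B) / (2 * a)"
  have ac: "4 * a * c > 0" using assms by simp
  have s2: "s\<^sup>2 = B\<^sup>2 + 4 * a * c"
    unfolding s_def using ac by (intro real_sqrt_pow2) (simp add: add_nonneg_nonneg)
  have "\<bar>B\<bar> < s"
    unfolding s_def using ac by (intro real_less_rsqrt) simp
  then have z: "z > 0"
    unfolding z_def using assms by simp
  have "s = 2 * a * z + B"
    unfolding z_def using assms by simp
  then have "(2 * a * z + B)\<^sup>2 = B\<^sup>2 + 4 * a * c"
    using s2 by simp
  then have "4 * a * (a * z\<^sup>2 + B * z) = 4 * a * c"
    by (simp add: power2_eq_square algebra_simps)
  then have "a * z\<^sup>2 + B * z = c"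
    using assms by simp
  then have "c / z - a * z = B"
    using z by (simp add: field_simps power2_eq_square)
  then show thesis using z that by blast
qed

text \<open>Collecting both terms linear in \<open>z\<close> gives the shape
  \<open>c / z - a * z = B\<close> treated above.\<close>

lemma horizon_eq_iff:
  "horizon_eq d \<mu> \<alpha> \<beta> T z \<longleftrightarrow>
    real d / z - ((real d - 2)\<^sup>2 * \<mu>\<^sup>2 / (2 * (real d - 1)) + \<beta>) * z = 4 * pi * T + \<alpha>"
  unfolding horizon_eq_def by (auto simp: algebra_simps)

lemma horizon_coeff_pos:
  fixes \<mu> \<beta> :: real
  assumes "d \<ge> 3" "\<mu> \<noteq> 0" "\<beta> \<ge> 0"
  shows "(real d - 2)\<^sup>2 * \<mu>\<^sup>2 / (2 * (real d - 1)) + \<beta> > 0"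
  using assms by (intro add_pos_nonneg divide_pos_pos mult_pos_pos) auto

lemma horizon_eq_strict_antimono:
  assumes "d \<ge> 3" "\<mu> \<noteq> 0" "\<beta> \<ge> 0"
    and "z > 0" "w > 0" "horizon_eq d \<mu> \<alpha> \<beta> S z" "horizon_eq d \<mu> \<alpha> \<beta> T w" "S < T"
  shows "w < z"
proof (rule ccontr)
  let ?a = "(real d - 2)\<^sup>2 * \<mu>\<^sup>2 / (2 * (real d - 1)) + \<beta>"
  assume "\<not> w < z"
  then have "real d / w - ?a * w \<le> real d / z - ?a * z"
    using divide_minus_mult_strict_antimono[OF horizon_coeff_pos[OF assms(1-3)], of "real d" z w]
      assms(1,4) by (cases "z = w") auto
  moreover have "4 * pi * S < 4 * pi * T"
    using assms(8) by simp
  ultimately show False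
    using assms(6,7) unfolding horizon_eq_iff by linarith
qed

lemma ex1_horizon_eq:
  assumes "d \<ge> 3" "\<mu> \<noteq> 0" "\<beta> \<ge> 0"
  shows "\<exists>!z. z > 0 \<and> horizon_eq d \<mu> \<alpha> \<beta> T z"
proof -
  let ?a = "(real d - 2)\<^sup>2 * \<mu>\<^sup>2 / (2 * (real d - 1)) + \<beta>"
  have d: "real d > 0" using assms(1) by simp
  note a = horizon_coeff_pos[OF assms]
  obtain z where "z > 0" "real d / z - ?a * z = 4 * pi * T + \<alpha>"
    using divide_minus_mult_surj[OF a d] by blast
  moreover have "w = v"
    if "w > 0" "v > 0" "real d / w - ?a * w = real d / v - ?a * v" for w v
    using divide_minus_mult_strict_antimono[OF a d, of w v]
      divide_minus_mult_strict_antimono[OF a d, of v w] that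
    by (cases w v rule: linorder_cases) auto
  ultimately show ?thesis
    unfolding horizon_eq_iff by (intro ex1I[of _ z]) auto
qed

lemma
  assumes "d \<ge> 3" "\<mu> \<noteq> 0" "\<beta> \<ge> 0"
  shows z0_pos: "z0 d \<mu> \<alpha> \<beta> T > 0"
    and horizon_eq_z0: "horizon_eq d \<mu> \<alpha> \<beta> T (z0 d \<mu> \<alpha> \<beta> T)"
  using theI'[OF ex1_horizon_eq[OF assms, of \<alpha> T]] unfolding z0_def by auto

lemma z0_strict_antimono:
  assumes "d \<ge> 3" "\<mu> \<noteq> 0" "\<beta> \<ge> 0" "S < T"
  shows "z0 d \<mu> \<alpha> \<beta> T < z0 d \<mu> \<alpha> \<beta> S"
  using horizon_eq_strict_antimono[OF assms(1-3) z0_pos z0_pos horizon_eq_z0 horizon_eq_z0 assms(4)]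
    assms(1-3) by blast

text \<open>This serves d = 3, where the power of \<open>z\<close> is 1. The denominator falls as
  \<open>z\<close> grows and stays positive because of the term with
  \<open>\<alpha>\<close>.\<close>

lemma conductivity_strict_mono:
  fixes K \<alpha> \<beta> z w :: real
  assumes "K > 0" "\<alpha> > 0" "\<beta> \<ge> 0" "0 < z" "z < w"
  shows "1 + K / (2 * \<beta> + \<alpha> * inverse z) < 1 + K / (2 * \<beta> + \<alpha> * inverse w)"
proof -
  have "2 * \<beta> + \<alpha> * inverse w > 0"
    using assms by (intro add_nonneg_pos mult_pos_pos) auto
  moreover have "2 * \<beta> + \<alpha> * inverse w < 2 * \<beta> + \<alpha> * inverse z"
    using assms by (simp add: less_imp_inverse_less)
  ultimately show ?thesis
    using assms(1) by (intro add_strict_left_mono divide_strict_left_mono mult_pos_pos) auto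
qed

text \<open>Here \<open>Suc n\<close> stands for d - 3. Pulling \<open>inverse z\<close> out of the
  denominator cancels one power of \<open>z\<close>, so monotonicity can be read off each
  summand.\<close>

lemma conductivity_eq:
  fixes K \<alpha> \<beta> z :: real
  assumes "z > 0"
  shows "z powi (- int (Suc n)) * (1 + K / (2 * \<beta> + \<alpha> * inverse z)) =
    inverse (z ^ Suc n) + K * inverse (z ^ n * (2 * \<beta> * z + \<alpha>))"
proof -
  have "2 * \<beta> + \<alpha> * inverse z = (2 * \<beta> * z + \<alpha>) * inverse z"
    using assms by (simp add: field_simps)
  then have "K / (2 * \<beta> + \<alpha> * inverse z) = K * z * inverse (2 * \<beta> * z + \<alpha>)"
    by (simp add: divide_inverse)
  moreover have "z powi (- int (Suc n)) = inverse (z ^ Suc n)"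
    by (simp only: power_int_minus power_int_of_nat)
  moreover have "inverse (z ^ Suc n) * z = inverse (z ^ n)"
    using assms by simp
  \<comment> \<open>The first pass distributes and moves \<open>K\<close> to the front;
    reassociating to the left then puts \<open>inverse (z ^ Suc n)\<close> next to \<open>z\<close>,
    where the third fact applies.\<close>
  ultimately show ?thesis
    by (simp only: distrib_left[of _ 1] mult_1_right inverse_mult_distrib mult.assoc
        mult.left_commute[of _ K]) (simp only: mult.assoc[symmetric])
qed

lemma conductivity_strict_antimono:
  fixes K \<alpha> \<beta> z w :: real
  assumes "K > 0" "\<alpha> \<ge> 0" "\<beta> \<ge> 0" "\<alpha> + \<beta> > 0" "0 < z" "z < w"
  shows "w powi (- int (Suc n)) * (1 + K / (2 * \<beta> + \<alpha> * inverse w))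
    < z powi (- int (Suc n)) * (1 + K / (2 * \<beta> + \<alpha> * inverse z))"
proof -
  \<comment> \<open>If \<open>\<beta> = 0\<close>, then \<open>\<alpha>\<close> is positive;
    otherwise \<open>2 * \<beta> * z\<close> is.\<close>
  have pos: "2 * \<beta> * z + \<alpha> > 0"
    using assms by (cases "\<beta> = 0") (auto intro: add_pos_nonneg)
  have le: "2 * \<beta> * z + \<alpha> \<le> 2 * \<beta> * w + \<alpha>"
    using assms by (simp add: mult_left_mono)
  have "inverse (w ^ Suc n) < inverse (z ^ Suc n)"
    using assms by (intro less_imp_inverse_less power_strict_mono zero_less_power) auto
  moreover have "z ^ n * (2 * \<beta> * z + \<alpha>) \<le> w ^ n * (2 * \<beta> * w + \<alpha>)"
    using assms pos le by (intro mult_mono power_mono) auto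
  then have "K * inverse (w ^ n * (2 * \<beta> * w + \<alpha>)) \<le> K * inverse (z ^ n * (2 * \<beta> * z + \<alpha>))"
    using assms pos by (intro mult_left_mono le_imp_inverse_le mult_pos_pos) auto
  ultimately show ?thesis
    using assms by (simp only: conductivity_eq less_trans[OF assms(5,6)] add_less_le_mono)
qed

theorem mainTheorem3:
  fixes d :: nat and \<mu> \<alpha> \<beta> :: real
  assumes "d \<ge> 3" and "\<mu> \<noteq> 0" and "\<alpha> \<ge> 0" and "\<beta> \<ge> 0" and "\<alpha> + \<beta> > 0"
  shows "(\<forall>T\<ge>0. \<exists>!z. z > 0 \<and> horizon_eq d \<mu> \<alpha> \<beta> T z)
    \<and> strict_antimono_on {0..} (z0 d \<mu> \<alpha> \<beta>)
    \<and> (d = 3 \<and> \<alpha> > 0 \<longrightarrow> strict_antimono_on {0..} (sigma_DC d \<mu> \<alpha> \<beta>))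
    \<and> (d = 3 \<and> \<alpha> = 0 \<longrightarrow> sigma_DC d \<mu> \<alpha> \<beta> constant_on {0..})
    \<and> (d > 3 \<longrightarrow> strict_mono_on {0..} (sigma_DC d \<mu> \<alpha> \<beta>))"
proof (intro conjI impI)
  let ?K = "(real d - 2)\<^sup>2 * \<mu>\<^sup>2"
  note pos = z0_pos[OF assms(1,2,4)]
  note anti = z0_strict_antimono[OF assms(1,2,4)]
  have K: "?K > 0"
    using assms(1,2) by (intro mult_pos_pos) auto
  show "\<forall>T\<ge>0. \<exists>!z. z > 0 \<and> horizon_eq d \<mu> \<alpha> \<beta> T z"
    using ex1_horizon_eq[OF assms(1,2,4)] by blast
  show "strict_antimono_on {0..} (z0 d \<mu> \<alpha> \<beta>)"
    by (intro monotone_onI anti)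
  show "strict_antimono_on {0..} (sigma_DC d \<mu> \<alpha> \<beta>)" if "d = 3 \<and> \<alpha> > 0"
  proof (rule monotone_onI)
    fix S T :: real assume "S < T"
    \<comment> \<open>The horizon at \<open>T\<close> is the smaller one, so it takes the place of
      \<open>z\<close> and the one at \<open>S\<close> that of \<open>w\<close>.\<close>
    from conductivity_strict_mono[OF K _ assms(4) pos anti[OF this]] that
    show "sigma_DC d \<mu> \<alpha> \<beta> T < sigma_DC d \<mu> \<alpha> \<beta> S"
      by (simp add: sigma_DC_def Let_def)
  qed
  show "sigma_DC d \<mu> \<alpha> \<beta> constant_on {0..}" if "d = 3 \<and> \<alpha> = 0"
    \<comment> \<open>Both the power and the denominator lose their dependence on the horizon: the
      value is \<open>1 + \<mu>\<^sup>2 / (2 * \<beta>)\<close>.\<close>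
    using that by (auto simp: constant_on_def sigma_DC_def Let_def)
  show "strict_mono_on {0..} (sigma_DC d \<mu> \<alpha> \<beta>)" if "d > 3"
  proof (rule monotone_onI)
    fix S T :: real assume "S < T"
    \<comment> \<open>As d > 3, the truncated subtraction \<open>d - 4\<close> is exact.\<close>
    have n: "- (int d - 3) = - int (Suc (d - 4))"
      using that by simp
    show "sigma_DC d \<mu> \<alpha> \<beta> S < sigma_DC d \<mu> \<alpha> \<beta> T"
      using conductivity_strict_antimono[OF K assms(3-5) pos anti[OF \<open>S < T\<close>]]
      unfolding sigma_DC_def Let_def n .
  qed
qed

end
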